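(* Let $\{k_n\}_{n=0}^\infty$ be a building sequence (with associated limits $a$ and $b$) of the family of random multi-hooking networks $\{G_n\}_{n\ge 1}$, starting from a seed $G_0$ with $\tau_0\ge2$ vertices and hook $h$. Let $d^*$ be the smallest degree in the seed and let $X_0$ be the number of nodes of degree $d^*$ in the seed. Let $X_n$ be the number of vertices of degree $d^*$ in the graph $G_n$ obtained after $n$ steps of evolution according to the building sequence. Let $\mathbb{I}_{A_0}$ equal $1$ if $\deg(h)=d^*$ in the seed, and $0$ otherwise. Then, for $n\ge 1$, $$\mathbb{E}[X_n]=(X_0-\mathbb{I}_{A_0})\sum_{i=1}^n k_{i-1}\prod_{j=i+1}^n\Big(1-\frac{k_{j-1}}{\tau_{j-1}}\Big)+X_0\prod_{j=1}^n\Big(1-\frac{k_{j-1}}{\tau_{j-1}}\Big),$$ where an empty product equals $1$. Moreover, the average proportion converges to a limit independent of $a$ and $b$, namely $$\mathbb{E}\Big[\frac{X_n}{\tau_n}\Big]\to\frac{X_0-\mathbb{I}_{A_0}}{\tau_0}\qquad\text{as } n\to\infty.$$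
   Context: Seed. $G_0$ is a connected finite graph (loops and multiple edges are allowed; a loop contributes 2 to the degree of its vertex) with $\tau_0\ge 2$ vertices, one of which is designated as the hook $h$. Building sequence. A sequence of integers $\{k_n\}_{n=0}^\infty$ with $k_n\ge 1$ is a building sequence (for a seed of order $\tau_0$) if: (i) $k_n\le \tau_0+(\tau_0-1)\sum_{i=0}^{n-1}k_i$ for all $n\ge 0$; (ii) the limit $a:=\lim_{n\to\infty} k_n/\sum_{i=0}^n k_i$ exists in $[0,1]$; (iii) the limit $b:=\lim_{n\to\infty}\tau_0/k_n\ge 0$ exists. Random multi-hooking network. For $n\ge 1$, given $G_{n-1}=(V_{n-1},\mathcal{E}_{n-1})$, a set of $k_{n-1}$ distinct vertices of $G_{n-1}$, called latches, is chosen uniformly at random among all subsets of $V_{n-1}$ of size $k_{n-1}$ (given the whole past). For each latch a fresh copy of the seed is taken and its hook is fused (identified) with the latch; distinct latches receive distinct copies. The result is $G_n$. The order of $G_n$ is deterministic: $\tau_n=|V_n|=\tau_0+(\tau_0-1)\sum_{i=1}^n k_{i-1}$. *)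

theory Defs
  imports "HOL-Probability.Probability" "HOL-Library.Uprod"
begin

section \<open>Finite graphs with loops and multiple edges\<close>

text \<open>An edge is an unordered pair of end vertices, \<open>Upair u u\<close> being a loop at \<open>u\<close>; parallel
  edges are recorded by multiplicity.\<close>

datatype 'v mgraph = MGraph (verts: "'v set") (edges: "'v uprod multiset")

definition finite_mgraph :: "'v mgraph \<Rightarrow> bool" where
  "finite_mgraph G \<longleftrightarrow> finite (verts G) \<and> (\<forall>e\<in>#edges G. set_uprod e \<subseteq> verts G)"

definition connected_mgraph :: "'v mgraph \<Rightarrow> bool" where
  "connected_mgraph G \<longleftrightarrow> verts G \<noteq> {} \<and>
     (\<forall>u\<in>verts G. \<forall>v\<in>verts G. (u, v) \<in> {(x, y). Upair x y \<in># edges G}\<^sup>*)"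

text \<open>The second summand makes a loop contribute 2.\<close>

definition vdegree :: "'v mgraph \<Rightarrow> 'v \<Rightarrow> nat" where
  "vdegree G v = size {#e \<in># edges G. v \<in> set_uprod e#} + size {#e \<in># edges G. e = Upair v v#}"

definition min_degree :: "'v mgraph \<Rightarrow> nat" where
  "min_degree G = Min (vdegree G ` verts G)"

definition num_degree :: "'v mgraph \<Rightarrow> nat \<Rightarrow> nat" where
  "num_degree G d = card {v \<in> verts G. vdegree G v = d}"


section \<open>Seeds and building sequences\<close>

definition is_seed :: "'v mgraph \<Rightarrow> 'v \<Rightarrow> bool" where
  "is_seed G h \<longleftrightarrow> finite_mgraph G \<and> connected_mgraph G \<and> card (verts G) \<ge> 2 \<and> h \<in> verts G"

definition building_sequence :: "nat \<Rightarrow> (nat \<Rightarrow> nat) \<Rightarrow> real \<Rightarrow> real \<Rightarrow> bool" where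
  "building_sequence \<tau>\<^sub>0 k a b \<longleftrightarrow>
     (\<forall>n. k n \<ge> 1) \<and>
     (\<forall>n. k n \<le> \<tau>\<^sub>0 + (\<tau>\<^sub>0 - 1) * (\<Sum>i<n. k i)) \<and>
     (\<lambda>n. real (k n) / (\<Sum>i\<le>n. real (k i))) \<longlonglongrightarrow> a \<and> 0 \<le> a \<and> a \<le> 1 \<and>
     (\<lambda>n. real \<tau>\<^sub>0 / real (k n)) \<longlonglongrightarrow> b \<and> 0 \<le> b"

definition tau :: "nat \<Rightarrow> (nat \<Rightarrow> nat) \<Rightarrow> nat \<Rightarrow> nat" where
  "tau \<tau>\<^sub>0 k n = \<tau>\<^sub>0 + (\<tau>\<^sub>0 - 1) * (\<Sum>i=1..n. k (i - 1))"


section \<open>The random multi-hooking network\<close>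

text \<open>\<open>Copy n w v\<close> is the non-hook vertex \<open>v\<close> of the copy of the seed that is hooked to the latch
  \<open>w\<close> at step \<open>n\<close>. Vertices of distinct copies are thus distinct, and \<open>G\<^sub>n\<close> determines the latch
  sets of all earlier steps, so that conditioning on the whole past is conditioning on the
  current graph.\<close>

datatype 'v node = Seed 'v | Copy nat "'v node" 'v

definition fuse :: "'v \<Rightarrow> nat \<Rightarrow> 'v node \<Rightarrow> 'v \<Rightarrow> 'v node" where
  "fuse h n w v = (if v = h then w else Copy n w v)"

definition attach ::
  "'v mgraph \<Rightarrow> 'v \<Rightarrow> nat \<Rightarrow> 'v node mgraph \<Rightarrow> 'v node set \<Rightarrow> 'v node mgraph" where
  "attach G\<^sub>0 h n G L = MGraph
     (verts G \<union> (\<Union>w\<in>L. fuse h n w ` verts G\<^sub>0))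
     (edges G + (\<Sum>w\<in>L. image_mset (map_uprod (fuse h n w)) (edges G\<^sub>0)))"

primrec network :: "'v mgraph \<Rightarrow> 'v \<Rightarrow> (nat \<Rightarrow> nat) \<Rightarrow> nat \<Rightarrow> 'v node mgraph pmf" where
  "network G\<^sub>0 h k 0 =
     return_pmf (MGraph (Seed ` verts G\<^sub>0) (image_mset (map_uprod Seed) (edges G\<^sub>0)))"
| "network G\<^sub>0 h k (Suc n) =
     bind_pmf (network G\<^sub>0 h k n) (\<lambda>G.
       map_pmf (attach G\<^sub>0 h (Suc n) G) (pmf_of_set {L. L \<subseteq> verts G \<and> card L = k n}))"

text \<open>The order of \<open>G\<^sub>n\<close> is deterministic and equal to \<open>tau\<close>. The condition on the time stamps
  says that the names used at a later step are fresh.\<close>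

fun stamp :: "'v node \<Rightarrow> nat" where
  "stamp (Seed v) = 0"
| "stamp (Copy n w v) = n"

lemma verts_network:
  assumes seed: "is_seed G\<^sub>0 h" and k: "building_sequence (card (verts G\<^sub>0)) k a b"
    and G: "G \<in> set_pmf (network G\<^sub>0 h k n)"
  shows "finite (verts G) \<and> card (verts G) = tau (card (verts G\<^sub>0)) k n \<and>
         (\<forall>v\<in>verts G. stamp v \<le> n)"
  using G
proof (induction n arbitrary: G)
  case 0
  have "inj_on Seed (verts G\<^sub>0)" by (simp add: inj_on_def)
  with 0 seed show ?case
    by (auto simp: is_seed_def finite_mgraph_def tau_def card_image)
next
  case (Suc n)
  then obtain H where H: "H \<in> set_pmf (network G\<^sub>0 h k n)"
    and G: "G \<in> attach G\<^sub>0 h (Suc n) H ` set_pmf (pmf_of_set {L. L \<subseteq> verts H \<and> card L = k n})"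
    by auto
  have IH: "finite (verts H)" "card (verts H) = tau (card (verts G\<^sub>0)) k n"
    "\<And>v. v \<in> verts H \<Longrightarrow> stamp v \<le> n"
    using Suc.IH[OF H] by auto
  have shift: "(\<Sum>i=1..m. k (i - 1)) = (\<Sum>i<m. k i)" for m
    by (induction m) auto
  have "k n \<le> card (verts H)"
    using k unfolding IH(2) tau_def shift building_sequence_def by blast
  then obtain L\<^sub>0 where "L\<^sub>0 \<subseteq> verts H" "card L\<^sub>0 = k n"
    using obtain_subset_with_card_n by metis
  then have "set_pmf (pmf_of_set {L. L \<subseteq> verts H \<and> card L = k n}) = {L. L \<subseteq> verts H \<and> card L = k n}"
    using IH(1) by (intro set_pmf_of_set) auto
  then obtain L where L: "L \<subseteq> verts H" "card L = k n" and GL: "G = attach G\<^sub>0 h (Suc n) H L"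
    using G by auto
  let ?N = "(\<lambda>(w, v). Copy (Suc n) w v) ` (L \<times> (verts G\<^sub>0 - {h}))"
  have h: "h \<in> verts G\<^sub>0" "finite (verts G\<^sub>0)"
    using seed by (auto simp: is_seed_def finite_mgraph_def)
  have vG: "verts G = verts H \<union> ?N"
    using L h unfolding GL attach_def fuse_def by (auto split: if_splits)
  have finL: "finite L" using L IH(1) finite_subset by blast
  have "verts H \<inter> ?N = {}"
    using IH(3) by fastforce
  then have "card (verts G) = card (verts H) + card ?N"
    unfolding vG using IH(1) finL h by (intro card_Un_disjoint) auto
  also have "card ?N = k n * (card (verts G\<^sub>0) - 1)"
    using h L(2) by (subst card_image) (auto simp: inj_on_def card_cartesian_product)
  also have "card (verts H) + k n * (card (verts G\<^sub>0) - 1) = tau (card (verts G\<^sub>0)) k (Suc n)"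
    by (simp add: IH(2) tau_def algebra_simps)
  finally show ?case
    using IH finL h unfolding vG by (auto intro: le_SucI)
qed

end

theory Submission
  imports Defs
begin

text \<open>A latch has degree at least \<open>d\<close> and gains \<open>deg h \<ge> 1\<close>, so it does not have degree \<open>d\<close> after
  its step; all other old vertices keep their degree, and each copy of the seed brings
  \<open>c = X\<^sub>0 - \<I>\<close> new vertices of degree \<open>d\<close>. Since a uniform \<open>k\<^sub>n\<close>-subset of the vertices contains
  on average \<open>k\<^sub>n X\<^sub>n / \<tau>\<^sub>n\<close> vertices of degree \<open>d\<close>, the means \<open>x\<^sub>n\<close> of \<open>X\<^sub>n\<close> satisfy
  \<open>x\<^bsub>n+1\<^esub> = (1 - k\<^sub>n / \<tau>\<^sub>n) x\<^sub>n + c k\<^sub>n\<close>, which unrolls to the formula. As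
  \<open>\<tau>\<^bsub>n+1\<^esub> = \<tau>\<^sub>n + (\<tau>\<^sub>0 - 1) k\<^sub>n\<close>, the difference \<open>y\<^sub>n = x\<^sub>n - c \<tau>\<^sub>n / \<tau>\<^sub>0\<close> satisfies the homogeneous
  recurrence \<open>y\<^bsub>n+1\<^esub> = (1 - k\<^sub>n / \<tau>\<^sub>n) y\<^sub>n\<close>. Hence it stays bounded, while \<open>\<tau>\<^sub>n\<close> tends to infinity.\<close>

section \<open>Vertex degrees as sums over edges\<close>

definition incidence :: "'v \<Rightarrow> 'v uprod \<Rightarrow> nat" where
  "incidence v e = of_bool (v \<in> set_uprod e) + of_bool (e = Upair v v)"

text \<open>Both filters become weights of single edges, a loop having weight 2. As a sum over the
  edge multiset, the degree is additive in the edges and commutes with renaming them.\<close>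

lemma vdegree_eq_sum_incidence: "vdegree G v = (\<Sum>e\<in>#edges G. incidence v e)"
proof -
  have "size (filter_mset P M) = (\<Sum>e\<in>#M. of_bool (P e))" for P and M :: "'a uprod multiset"
    by (induction M) auto
  then show ?thesis
    by (simp add: vdegree_def incidence_def sum_mset.distrib)
qed

lemma incidence_eq_0: "v \<notin> set_uprod e \<Longrightarrow> incidence v e = 0"
  by (auto simp: incidence_def)

text \<open>Injectivity keeps other vertices from being sent to \<open>f v\<close> and proper edges
  from collapsing to loops.\<close>

lemma incidence_map_uprod:
  assumes "inj f"
  shows "incidence (f v) (map_uprod f e) = incidence v e"
  using assms by (cases e) (auto simp: incidence_def inj_eq)

lemma vdegree_eq_0:
  assumes "finite_mgraph G" and "v \<notin> verts G"
  shows "vdegree G v = 0"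
  using assms by (auto simp: vdegree_eq_sum_incidence finite_mgraph_def intro!: incidence_eq_0)

lemma min_degree_le:
  assumes "finite_mgraph G" and "v \<in> verts G"
  shows "min_degree G \<le> vdegree G v"
  using assms by (auto simp: min_degree_def finite_mgraph_def)

text \<open>The first edge of a path to a second vertex contains \<open>v\<close>. Applied to the
  hook, this makes the degree of every latch strictly increase.\<close>

lemma vdegree_pos:
  assumes "connected_mgraph G" and "card (verts G) \<ge> 2" and "v \<in> verts G"
  shows "vdegree G v > 0"
proof -
  have "verts G \<noteq> {v}"
    using assms(2) by auto
  then obtain u where u: "u \<in> verts G" "u \<noteq> v"
    using assms(3) by blast
  then have "(v, u) \<in> {(x, y). Upair x y \<in># edges G}\<^sup>*"
    using assms(1,3) by (simp add: connected_mgraph_def)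
  then obtain y where "Upair v y \<in># edges G"
    using u(2) by (auto elim: converse_rtranclE)
  then have "Upair v y \<in># {#e \<in># edges G. v \<in> set_uprod e#}"
    by simp
  then show ?thesis
    unfolding vdegree_def by (metis add_gr_0 empty_not_add_mset multi_member_split nonempty_has_size)
qed

lemma vdegree_Seed:
  "vdegree (MGraph V (image_mset (map_uprod Seed) (edges G))) (Seed v) = vdegree G v"
  by (simp add: vdegree_eq_sum_incidence image_mset.compositionality comp_def
      incidence_map_uprod inj_def)

section \<open>Degrees after copies of the seed are fused\<close>

lemma Copy_neq [simp]: "Copy n w v \<noteq> w" "w \<noteq> Copy n w v"
proof -
  have "size (Copy n w v) \<noteq> size w"
    by simp
  then show "Copy n w v \<noteq> w" "w \<noteq> Copy n w v"
    by metis+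
qed

text \<open>The hook goes to \<open>w\<close> and every other vertex to a term properly containing
  \<open>w\<close>, so a copy keeps all degrees of the seed.\<close>

lemma inj_fuse: "inj (fuse h n w)"
  by (auto simp: inj_def fuse_def)

lemma verts_attach:
  assumes "L \<subseteq> verts H" and "h \<in> verts G\<^sub>0"
  shows "verts (attach G\<^sub>0 h n H L) =
         verts H \<union> (\<lambda>(w, v). Copy n w v) ` (L \<times> (verts G\<^sub>0 - {h}))"
  using assms by (auto simp: attach_def fuse_def split: if_splits)

lemma finite_mgraph_attach:
  assumes "finite_mgraph G\<^sub>0" and "finite_mgraph H" and "finite L"
  shows "finite_mgraph (attach G\<^sub>0 h n H L)"
proof -
  have "set_uprod e \<subseteq> verts (attach G\<^sub>0 h n H L)" if "e \<in># edges (attach G\<^sub>0 h n H L)" for e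
  proof -
    from that consider "e \<in># edges H"
      | w e' where "w \<in> L" "e' \<in># edges G\<^sub>0" "e = map_uprod (fuse h n w) e'"
      using assms(3) by (auto simp: attach_def set_mset_sum)
    then show ?thesis
    proof cases
      case 1
      then show ?thesis
        using assms(2) by (auto simp: finite_mgraph_def attach_def)
    next
      case 2
      then have "set_uprod e \<subseteq> fuse h n w ` verts G\<^sub>0"
        using assms(1) by (auto simp: finite_mgraph_def uprod.set_map)
      with 2(1) show ?thesis
        by (auto simp: attach_def)
    qed
  qed
  then show ?thesis
    using assms by (auto simp: finite_mgraph_def attach_def)
qed

lemma vdegree_attach:
  "vdegree (attach G\<^sub>0 h n H L) u =
   vdegree H u + (\<Sum>w\<in>L. \<Sum>e\<in>#edges G\<^sub>0. incidence u (map_uprod (fuse h n w) e))"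
proof -
  have "sum_mset (image_mset (incidence u) (sum F A)) = (\<Sum>w\<in>A. \<Sum>e\<in>#F w. incidence u e)"
    for F :: "'a node \<Rightarrow> 'a node uprod multiset" and A
    \<comment> \<open>For infinite \<open>A\<close> the multiset sum is empty and the right-hand sum
      is 0 by convention.\<close>
    by (induction A rule: infinite_finite_induct) auto
  then show ?thesis
    by (simp add: vdegree_eq_sum_incidence attach_def image_mset.compositionality comp_def)
qed

lemma sum_incidence_fuse_eq_0:
  assumes "finite_mgraph G\<^sub>0" and "u \<notin> fuse h n w ` verts G\<^sub>0"
  shows "(\<Sum>e\<in>#edges G\<^sub>0. incidence u (map_uprod (fuse h n w) e)) = 0"
proof -
  have "u \<notin> set_uprod (map_uprod (fuse h n w) e)" if "e \<in># edges G\<^sub>0" for e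
    using that assms by (auto simp: finite_mgraph_def uprod.set_map)
  then show ?thesis
    by (simp add: incidence_eq_0)
qed

lemma sum_incidence_fuse:
  "(\<Sum>e\<in>#edges G\<^sub>0. incidence (fuse h n w v) (map_uprod (fuse h n w) e)) = vdegree G\<^sub>0 v"
  by (simp add: incidence_map_uprod[OF inj_fuse] vdegree_eq_sum_incidence)

text \<open>Every vertex of a copy is a latch or has stamp \<open>n\<close>, so no new edge meets
  \<open>u\<close>.\<close>

lemma vdegree_attach_old:
  assumes "finite_mgraph G\<^sub>0" and "stamp u < n" and "u \<notin> L"
  shows "vdegree (attach G\<^sub>0 h n H L) u = vdegree H u"
proof -
  have "u \<notin> fuse h n w ` verts G\<^sub>0" if "w \<in> L" for w
    using that assms(2,3) by (auto simp: fuse_def split: if_splits)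
  then show ?thesis
    using assms(1) by (simp add: vdegree_attach sum_incidence_fuse_eq_0)
qed

text \<open>Only the copy at \<open>w\<close> reaches this vertex. The case \<open>v = h\<close>
  describes the latch itself, the case \<open>v \<noteq> h\<close> a new vertex.\<close>

lemma vdegree_attach_fuse:
  assumes "finite_mgraph G\<^sub>0" and "finite L" and "w \<in> L" and "\<And>w. w \<in> L \<Longrightarrow> stamp w < n"
  shows "vdegree (attach G\<^sub>0 h n H L) (fuse h n w v) = vdegree H (fuse h n w v) + vdegree G\<^sub>0 v"
proof -
  \<comment> \<open>New vertices of different copies record different latches, and a latch has stamp
    below \<open>n\<close>, hence is not a new vertex.\<close>
  have "fuse h n w v \<notin> fuse h n w' ` verts G\<^sub>0" if "w' \<in> L - {w}" for w'
    using that assms(3) assms(4)[of w] assms(4)[of w'] by (auto simp: fuse_def split: if_splits)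
  then have "(\<Sum>w'\<in>L - {w}. \<Sum>e\<in>#edges G\<^sub>0.
      incidence (fuse h n w v) (map_uprod (fuse h n w') e)) = 0"
    using assms(1) by (intro sum.neutral ballI sum_incidence_fuse_eq_0)
  then show ?thesis
    by (simp add: vdegree_attach sum.remove[OF assms(2,3)] sum_incidence_fuse)
qed

lemma vdegree_attach_latch:
  assumes "finite_mgraph G\<^sub>0" and "finite L" and "w \<in> L" and "\<And>w. w \<in> L \<Longrightarrow> stamp w < n"
  shows "vdegree (attach G\<^sub>0 h n H L) w = vdegree H w + vdegree G\<^sub>0 h"
  using vdegree_attach_fuse[OF assms, where v = h and h = h] by (simp add: fuse_def)

text \<open>The stamp \<open>n\<close> puts the vertex outside \<open>H\<close>, whose edges
  therefore contribute nothing.\<close>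

lemma vdegree_attach_Copy:
  assumes "finite_mgraph G\<^sub>0" and "finite L" and "w \<in> L" and "\<And>w. w \<in> L \<Longrightarrow> stamp w < n"
    and "finite_mgraph H" and "\<And>u. u \<in> verts H \<Longrightarrow> stamp u < n" and "v \<noteq> h"
  shows "vdegree (attach G\<^sub>0 h n H L) (Copy n w v) = vdegree G\<^sub>0 v"
proof -
  have "Copy n w v \<notin> verts H"
    using assms(6) by fastforce
  then show ?thesis
    using vdegree_attach_fuse[OF assms(1-4), where v = v and h = h] assms(5,7)
    by (simp add: fuse_def vdegree_eq_0)
qed

text \<open>Balance for a fixed latch set: latches of degree \<open>d\<close> are lost, and each
  copy brings its non-hook vertices of degree \<open>d\<close>. Subtraction is taken in the reals so
  that expectations apply linearly.\<close>

lemma num_degree_attach: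
  assumes "finite_mgraph G\<^sub>0" and "h \<in> verts G\<^sub>0" and "vdegree G\<^sub>0 h > 0"
    and H: "finite_mgraph H" "\<And>u. u \<in> verts H \<Longrightarrow> stamp u < n" "\<And>u. u \<in> verts H \<Longrightarrow> d \<le> vdegree H u"
    and L: "L \<subseteq> verts H"
  shows "real (num_degree (attach G\<^sub>0 h n H L) d) =
         real (num_degree H d) - real (card (L \<inter> {v \<in> verts H. vdegree H v = d})) +
         real (card L) * (real (num_degree G\<^sub>0 d) - of_bool (vdegree G\<^sub>0 h = d))"
proof -
  define A where "A = {v \<in> verts H. vdegree H v = d}"
  define B where "B = {v \<in> verts G\<^sub>0. vdegree G\<^sub>0 v = d}"
  have fin: "finite A" "finite B" "finite L"
    using assms(1) H(1) L by (auto simp: A_def B_def finite_mgraph_def intro: finite_subset)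
  have stampL: "\<And>w. w \<in> L \<Longrightarrow> stamp w < n"
    using L H(2) by blast
  let ?G = "attach G\<^sub>0 h n H L"
  let ?N = "(\<lambda>(w, v). Copy n w v) ` (L \<times> (B - {h}))"
  \<comment> \<open>A latch ends strictly above \<open>d\<close>, since it starts at
    \<open>d\<close> or more and gains the positive degree of the hook.\<close>
  have old: "vdegree ?G u = d \<longleftrightarrow> u \<in> A - L" if u: "u \<in> verts H" for u
  proof (cases "u \<in> L")
    case True
    then show ?thesis
      using vdegree_attach_latch[OF assms(1) fin(3) _ stampL, of u h H] H(3)[OF u] assms(3) by simp
  next
    case False
    then show ?thesis
      using vdegree_attach_old[OF assms(1) H(2)[OF u]] u by (simp add: A_def)
  qed
  have new: "vdegree ?G (Copy n w v) = vdegree G\<^sub>0 v" if "w \<in> L" "v \<noteq> h" for w v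
    using vdegree_attach_Copy[OF assms(1) fin(3) that(1) stampL H(1) H(2) that(2)] .
  have "{v \<in> verts ?G. vdegree ?G v = d} = (A - L) \<union> ?N"
    unfolding verts_attach[OF L assms(2)] using old new by (auto simp: A_def B_def)
  moreover have "(A - L) \<inter> ?N = {}"
    using H(2) by (fastforce simp: A_def)
  ultimately have "num_degree ?G d = card (A - L) + card ?N"
    using fin by (simp add: num_degree_def card_Un_disjoint)
  moreover have "card ?N = card L * card (B - {h})"
    by (subst card_image) (auto simp: inj_on_def card_cartesian_product)
  \<comment> \<open>If the hook has degree \<open>d\<close>, then \<open>B\<close> is nonempty and
    the natural-number subtraction is not truncated.\<close>
  moreover have "real (card (B - {h})) = real (card B) - of_bool (vdegree G\<^sub>0 h = d)"
    using fin(2) assms(2) card_gt_0_iff[of B] by (auto simp: B_def card_Diff_singleton_if of_nat_diff)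
  moreover have "real (card (A - L)) = real (card A) - real (card (L \<inter> A))"
    using fin(1) by (simp add: card_Diff_subset_Int Int_commute of_nat_diff card_mono)
  ultimately show ?thesis
    by (simp add: num_degree_def A_def B_def)
qed

text \<open>Old degrees never decrease, and a new vertex has its degree in the seed.\<close>

lemma vdegree_attach_ge:
  assumes "finite_mgraph G\<^sub>0" and "h \<in> verts G\<^sub>0" and "d \<le> min_degree G\<^sub>0"
    and H: "finite_mgraph H" "\<And>u. u \<in> verts H \<Longrightarrow> stamp u < n" "\<And>u. u \<in> verts H \<Longrightarrow> d \<le> vdegree H u"
    and L: "L \<subseteq> verts H" and u: "u \<in> verts (attach G\<^sub>0 h n H L)"
  shows "d \<le> vdegree (attach G\<^sub>0 h n H L) u"
proof -
  have fin: "finite L"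
    using H(1) L by (auto simp: finite_mgraph_def intro: finite_subset)
  have stampL: "\<And>w. w \<in> L \<Longrightarrow> stamp w < n"
    using L H(2) by blast
  from u consider "u \<in> verts H" | w v where "w \<in> L" "v \<in> verts G\<^sub>0" "v \<noteq> h" "u = Copy n w v"
    unfolding verts_attach[OF L assms(2)] by auto
  then show ?thesis
  proof cases
    case 1
    then show ?thesis
      using H(3) by (simp add: vdegree_attach trans_le_add1)
  next
    case 2
    then show ?thesis
      using vdegree_attach_Copy[OF assms(1) fin 2(1) stampL H(1) H(2) 2(3)]
        min_degree_le[OF assms(1) 2(2)] assms(3) by simp
  qed
qed

section \<open>Mean number of marked elements in a uniform subset\<close>

lemma expectation_card_Int_random_subset:
  fixes V A :: "'a set"
  assumes "finite V" and "A \<subseteq> V" and "1 \<le> m" and "m \<le> card V"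
  shows "measure_pmf.expectation (pmf_of_set {L. L \<subseteq> V \<and> card L = m}) (\<lambda>L. real (card (L \<inter> A))) =
         real m * real (card A) / real (card V)"
proof -
  define S where "S = {L. L \<subseteq> V \<and> card L = m}"
  have finS: "finite S"
    using assms(1) by (simp add: S_def)
  have cardS: "card S = card V choose m"
    using n_subsets[OF assms(1)] by (simp add: S_def)
  have "S \<noteq> {}"
    using cardS assms(4) by (metis card.empty binomial_eq_0_iff not_le)
  \<comment> \<open>Deleting \<open>x\<close> matches the \<open>m\<close>-subsets containing
    \<open>x\<close> with the \<open>(m - 1)\<close>-subsets of \<open>V - {x}\<close>;
    \<open>1 \<le> m\<close> makes \<open>m - 1\<close> a true predecessor.\<close>
  have count: "card {L \<in> S. x \<in> L} = (card V - 1) choose (m - 1)" if x: "x \<in> A" for x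
  proof -
    have "bij_betw (insert x) {L. L \<subseteq> V - {x} \<and> card L = m - 1} {L \<in> S. x \<in> L}"
    proof (rule bij_betwI[where g = "\<lambda>L. L - {x}"])
      show "insert x \<in> {L. L \<subseteq> V - {x} \<and> card L = m - 1} \<rightarrow> {L \<in> S. x \<in> L}"
      proof
        fix L assume L: "L \<in> {L. L \<subseteq> V - {x} \<and> card L = m - 1}"
        then have "finite L" "x \<notin> L"
          using assms(1) by (auto intro: finite_subset[of L V])
        with L show "insert x L \<in> {L \<in> S. x \<in> L}"
          using assms(2,3) x by (auto simp: S_def)
      qed
    next
      show "(\<lambda>L. L - {x}) \<in> {L \<in> S. x \<in> L} \<rightarrow> {L. L \<subseteq> V - {x} \<and> card L = m - 1}"
        by (auto simp: S_def)
    qed auto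
    then have "card {L \<in> S. x \<in> L} = card {L. L \<subseteq> V - {x} \<and> card L = m - 1}"
      by (simp add: bij_betw_same_card)
    then show ?thesis
      using n_subsets[of "V - {x}" "m - 1"] assms(1,2) x by auto
  qed
  \<comment> \<open>Double counting of the pairs \<open>(L, x)\<close> with
    \<open>x \<in> L \<inter> A\<close>.\<close>
  have "(\<Sum>L\<in>S. real (card (L \<inter> A))) = (\<Sum>L\<in>S. \<Sum>x\<in>A. of_bool (x \<in> L))"
    using finite_subset[OF assms(2,1)] by (simp add: Int_commute Int_def sum.If_cases of_bool_def)
  also have "\<dots> = (\<Sum>x\<in>A. \<Sum>L\<in>S. of_bool (x \<in> L))"
    by (rule sum.swap)
  also have "\<dots> = (\<Sum>x\<in>A. real (card {L \<in> S. x \<in> L}))"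
    using finS by (simp add: Int_def of_bool_def sum.If_cases)
  also have "\<dots> = real (card A) * real ((card V - 1) choose (m - 1))"
    using count by simp
  finally have sum: "(\<Sum>L\<in>S. real (card (L \<inter> A))) = real (card A) * real ((card V - 1) choose (m - 1))" .
  \<comment> \<open>By the absorption identity the ratio of the two binomial coefficients is
    \<open>m / card V\<close>.\<close>
  have "m * card S = card V * ((card V - 1) choose (m - 1))"
    using times_binomial_minus1_eq[of m "card V"] assms(3) cardS by simp
  then have "real m * real (card S) = real (card V) * real ((card V - 1) choose (m - 1))"
    by (metis of_nat_mult)
  moreover have "card S > 0" "card V > 0"
    using \<open>S \<noteq> {}\<close> finS assms(1,3,4) by (auto simp: card_gt_0_iff)
  ultimately show ?thesis
    using \<open>S \<noteq> {}\<close> finS unfolding S_def[symmetric]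
    by (simp add: integral_pmf_of_set sum field_simps)
qed

section \<open>Growth of the order\<close>

lemma tau_0 [simp]: "tau \<tau>\<^sub>0 k 0 = \<tau>\<^sub>0"
  by (simp add: tau_def)

lemma tau_Suc: "tau \<tau>\<^sub>0 k (Suc n) = tau \<tau>\<^sub>0 k n + (\<tau>\<^sub>0 - 1) * k n"
  by (simp add: tau_def algebra_simps)

lemma building_sequence_le_tau:
  assumes "building_sequence \<tau>\<^sub>0 k a b"
  shows "k n \<le> tau \<tau>\<^sub>0 k n"
proof -
  have "tau \<tau>\<^sub>0 k n = \<tau>\<^sub>0 + (\<tau>\<^sub>0 - 1) * (\<Sum>i<n. k i)"
    by (induction n) (simp_all add: tau_Suc algebra_simps)
  then show ?thesis
    using assms by (simp add: building_sequence_def)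
qed

lemma building_sequence_pos: "building_sequence \<tau>\<^sub>0 k a b \<Longrightarrow> 1 \<le> k n"
  by (simp add: building_sequence_def)

text \<open>Each step adds at least one vertex. This crude bound yields both positivity and
  divergence of the order.\<close>

lemma less_tau:
  assumes "building_sequence \<tau>\<^sub>0 k a b" and "2 \<le> \<tau>\<^sub>0"
  shows "n < tau \<tau>\<^sub>0 k n"
proof (induction n)
  case (Suc n)
  have "1 * 1 \<le> (\<tau>\<^sub>0 - 1) * k n"
    using assms building_sequence_pos[OF assms(1)] by (intro mult_le_mono) auto
  with Suc show ?case
    unfolding tau_Suc by linarith
qed (use assms(2) in simp)

section \<open>Recurrence for the mean\<close>

locale hooking =
  fixes G\<^sub>0 :: "'v mgraph" and h :: 'v and k :: "nat \<Rightarrow> nat" and a b :: real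
  assumes seed: "is_seed G\<^sub>0 h" and building: "building_sequence (card (verts G\<^sub>0)) k a b"
begin

lemma seed_facts:
  "finite_mgraph G\<^sub>0" "connected_mgraph G\<^sub>0" "card (verts G\<^sub>0) \<ge> 2" "h \<in> verts G\<^sub>0"
  using seed by (auto simp: is_seed_def)

lemma network_facts:
  assumes "H \<in> set_pmf (network G\<^sub>0 h k n)"
  shows "finite (verts H)" "card (verts H) = tau (card (verts G\<^sub>0)) k n"
    "\<And>v. v \<in> verts H \<Longrightarrow> stamp v < Suc n"
  using verts_network[OF seed building assms] by (auto simp: less_Suc_eq_le)

text \<open>\<open>pmf_of_set\<close> has the expected support only on finite nonempty sets; a latch
  set exists because \<open>k n\<close> is at most the order.\<close>

lemma set_pmf_latches:
  assumes "H \<in> set_pmf (network G\<^sub>0 h k n)"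
  shows "set_pmf (pmf_of_set {L. L \<subseteq> verts H \<and> card L = k n}) = {L. L \<subseteq> verts H \<and> card L = k n}"
proof -
  have "k n \<le> card (verts H)"
    using building_sequence_le_tau[OF building] network_facts[OF assms] by simp
  then obtain L where "L \<subseteq> verts H" "card L = k n"
    using obtain_subset_with_card_n by metis
  then show ?thesis
    using network_facts(1)[OF assms] by (intro set_pmf_of_set) auto
qed

text \<open>Finite support makes every real function integrable and turns expectations into finite
  sums.\<close>

lemma finite_set_pmf_network: "finite (set_pmf (network G\<^sub>0 h k n))"
proof (induction n)
  case (Suc n)
  then show ?case
    using network_facts(1) by (auto simp: set_pmf_latches)
qed simp

text \<open>The minimal degree of the seed stays a lower bound for all degrees, as the balance for
  one step requires.\<close>

lemma network_invariant:
  assumes "H \<in> set_pmf (network G\<^sub>0 h k n)"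
  shows "finite_mgraph H \<and> (\<forall>u\<in>verts H. min_degree G\<^sub>0 \<le> vdegree H u)"
  using assms
proof (induction n arbitrary: H)
  case 0
  then have H: "H = MGraph (Seed ` verts G\<^sub>0) (image_mset (map_uprod Seed) (edges G\<^sub>0))"
    by simp
  have "finite_mgraph H"
    using seed_facts(1) by (auto simp: H finite_mgraph_def uprod.set_map)
  then show ?case
    using min_degree_le[OF seed_facts(1)] by (auto simp: H vdegree_Seed)
next
  case (Suc n)
  then obtain H' L where H': "H' \<in> set_pmf (network G\<^sub>0 h k n)" and L: "L \<subseteq> verts H'"
    and H: "H = attach G\<^sub>0 h (Suc n) H' L"
    by (auto simp: set_pmf_latches)
  have "finite L"
    using L network_facts(1)[OF H'] finite_subset by blast
  then show ?case
    unfolding H using finite_mgraph_attach seed_facts(1,4) Suc.IH[OF H'] L network_facts(3)[OF H']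
    by (auto intro!: vdegree_attach_ge)
qed

definition mean_X :: "nat \<Rightarrow> real" where
  "mean_X n =
     measure_pmf.expectation (network G\<^sub>0 h k n) (\<lambda>G. real (num_degree G (min_degree G\<^sub>0)))"

text \<open>The constant \<open>c\<close> of the recurrence: the number of non-hook seed vertices of
  minimal degree.\<close>

definition gain :: real where
  "gain = real (num_degree G\<^sub>0 (min_degree G\<^sub>0)) - of_bool (vdegree G\<^sub>0 h = min_degree G\<^sub>0)"

lemma expectation_num_degree_step:
  assumes H: "H \<in> set_pmf (network G\<^sub>0 h k n)"
  shows "measure_pmf.expectation (pmf_of_set {L. L \<subseteq> verts H \<and> card L = k n})
           (\<lambda>L. real (num_degree (attach G\<^sub>0 h (Suc n) H L) (min_degree G\<^sub>0))) =
         (1 - real (k n) / real (tau (card (verts G\<^sub>0)) k n)) * real (num_degree H (min_degree G\<^sub>0))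
         + gain * real (k n)"
proof -
  let ?p = "pmf_of_set {L. L \<subseteq> verts H \<and> card L = k n}"
  let ?d = "min_degree G\<^sub>0"
  let ?A = "{v \<in> verts H. vdegree H v = ?d}"
  have "finite (set_pmf ?p)"
    using network_facts(1)[OF H] by (simp add: set_pmf_latches[OF H])
  then have int: "integrable (measure_pmf ?p) f" for f :: "'v node set \<Rightarrow> real"
    by (rule integrable_measure_pmf_finite)
  have "measure_pmf.expectation ?p (\<lambda>L. real (num_degree (attach G\<^sub>0 h (Suc n) H L) ?d)) =
        measure_pmf.expectation ?p
          (\<lambda>L. real (num_degree H ?d) - real (card (L \<inter> ?A)) + real (k n) * gain)"
  \<comment> \<open>The balance holds for genuine latch sets only, that is, on the support.\<close>
  proof (intro integral_cong_AE)
    show "AE L in measure_pmf ?p. real (num_degree (attach G\<^sub>0 h (Suc n) H L) ?d) =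
        real (num_degree H ?d) - real (card (L \<inter> ?A)) + real (k n) * gain"
      using num_degree_attach[OF seed_facts(1,4) vdegree_pos[OF seed_facts(2-4)], of H "Suc n" ?d]
        network_invariant[OF H] network_facts(3)[OF H]
      by (auto simp: AE_measure_pmf_iff set_pmf_latches[OF H] gain_def)
  qed auto
  also have "\<dots> = real (num_degree H ?d) -
      measure_pmf.expectation ?p (\<lambda>L. real (card (L \<inter> ?A))) + real (k n) * gain"
    using int by simp
  also have "measure_pmf.expectation ?p (\<lambda>L. real (card (L \<inter> ?A))) =
      real (k n) * real (card ?A) / real (card (verts H))"
    using network_facts[OF H] building_sequence_le_tau[OF building] building_sequence_pos[OF building]
    by (intro expectation_card_Int_random_subset) auto
  finally show ?thesis
    using network_facts(2)[OF H] by (simp add: num_degree_def algebra_simps)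
qed

lemma mean_X_0: "mean_X 0 = real (num_degree G\<^sub>0 (min_degree G\<^sub>0))"
proof -
  let ?H = "MGraph (Seed ` verts G\<^sub>0) (image_mset (map_uprod Seed) (edges G\<^sub>0))"
  have "{u \<in> verts ?H. vdegree ?H u = d} = Seed ` {v \<in> verts G\<^sub>0. vdegree G\<^sub>0 v = d}" for d
    by (auto simp: vdegree_Seed)
  then show ?thesis
    by (simp add: mean_X_def num_degree_def card_image inj_on_def)
qed

text \<open>Conditioning on the current graph gives an affine function of its count. The
  coefficients are the same for all graphs of the support because the order is deterministic, so the
  recurrence closes in the mean.\<close>

lemma mean_X_Suc:
  "mean_X (Suc n) =
   (1 - real (k n) / real (tau (card (verts G\<^sub>0)) k n)) * mean_X n + gain * real (k n)"
proof -
  let ?p = "network G\<^sub>0 h k n"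
  let ?q = "\<lambda>H. pmf_of_set {L. L \<subseteq> verts H \<and> card L = k n}"
  let ?d = "min_degree G\<^sub>0"
  let ?r = "1 - real (k n) / real (tau (card (verts G\<^sub>0)) k n)"
  have int: "integrable (measure_pmf ?p) f" for f :: "'v node mgraph \<Rightarrow> real"
    using finite_set_pmf_network by (rule integrable_measure_pmf_finite)
  have fin: "finite (set_pmf (map_pmf (attach G\<^sub>0 h (Suc n) H) (?q H)))" if "H \<in> set_pmf ?p" for H
    using that network_facts(1)[OF that] by (simp add: set_pmf_latches)
  have "mean_X (Suc n) = (\<Sum>H\<in>set_pmf ?p. pmf ?p H *
      measure_pmf.expectation (?q H) (\<lambda>L. real (num_degree (attach G\<^sub>0 h (Suc n) H L) ?d)))"
    unfolding mean_X_def network.simps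
    by (subst pmf_expectation_bind[OF finite_set_pmf_network fin]) auto
  also have "\<dots> = (\<Sum>H\<in>set_pmf ?p. pmf ?p H * (?r * real (num_degree H ?d) + gain * real (k n)))"
    by (intro sum.cong refl) (simp add: expectation_num_degree_step)
  also have "\<dots> = measure_pmf.expectation ?p (\<lambda>H. ?r * real (num_degree H ?d) + gain * real (k n))"
    by (subst integral_measure_pmf_real[OF finite_set_pmf_network]) (auto simp: mult.commute)
  also have "\<dots> = ?r * mean_X n + gain * real (k n)"
    using int by (simp add: mean_X_def)
  finally show ?thesis .
qed

end

section \<open>Solution of the recurrence and its limit\<close>

lemma affine_recurrence_closed_form:
  fixes x r s :: "nat \<Rightarrow> 'a::comm_ring_1"
  assumes "\<And>n. x (Suc n) = r n * x n + c * s n"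
  shows "x n = c * (\<Sum>i=1..n. s (i - 1) * (\<Prod>j=i+1..n. r (j - 1))) + x 0 * (\<Prod>j=1..n. r (j - 1))"
proof (induction n)
  case (Suc n)
  \<comment> \<open>For \<open>i \<le> n\<close> the product gains the factor \<open>r n\<close>, at
    \<open>j = Suc n\<close>. The remaining summand \<open>i = Suc n\<close> has an empty product
    and supplies \<open>s n\<close>.\<close>
  have "(\<Sum>i=1..n. s (i - 1) * (\<Prod>j=i+1..Suc n. r (j - 1))) =
        r n * (\<Sum>i=1..n. s (i - 1) * (\<Prod>j=i+1..n. r (j - 1)))"
    unfolding sum_distrib_left by (intro sum.cong refl) (simp add: mult_ac)
  then show ?case
    using Suc by (simp add: assms algebra_simps)
qed simp

lemma (in hooking) mean_X_proportion_tendsto: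
  "(\<lambda>n. mean_X n / real (tau (card (verts G\<^sub>0)) k n)) \<longlonglongrightarrow> gain / real (card (verts G\<^sub>0))"
proof -
  let ?\<tau>\<^sub>0 = "card (verts G\<^sub>0)"
  let ?\<tau> = "tau ?\<tau>\<^sub>0 k"
  define y where "y n = mean_X n - gain * real (?\<tau> n) / real ?\<tau>\<^sub>0" for n
  have \<tau>: "n < ?\<tau> n" for n
    by (rule less_tau[OF building seed_facts(3)])
  have \<tau>_Suc: "real (?\<tau> (Suc n)) = real (?\<tau> n) + (real ?\<tau>\<^sub>0 - 1) * real (k n)" for n
    using seed_facts(3) by (simp add: tau_Suc of_nat_diff)
  \<comment> \<open>The forcing term cancels: \<open>gain * ?\<tau> n / ?\<tau>\<^sub>0\<close>
    solves the same affine recurrence, since the order grows by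
    \<open>(?\<tau>\<^sub>0 - 1) * k n\<close>.\<close>
  have y_Suc: "y (Suc n) = (1 - real (k n) / real (?\<tau> n)) * y n" for n
  proof -
    have "real (?\<tau> n) \<noteq> 0" "real ?\<tau>\<^sub>0 \<noteq> 0"
      using \<tau>[of n] seed_facts(3) by auto
    then show ?thesis
      by (simp add: y_def mean_X_Suc \<tau>_Suc field_simps)
  qed
  have y_bound: "\<bar>y n\<bar> \<le> \<bar>y 0\<bar>" for n
  proof (induction n)
    case (Suc n)
    \<comment> \<open>The factor lies in [0, 1] because at most all vertices are latches.\<close>
    have "\<bar>1 - real (k n) / real (?\<tau> n)\<bar> \<le> 1"
      using building_sequence_le_tau[OF building, of n] \<tau>[of n] by (simp add: abs_if field_simps)
    then have "\<bar>y (Suc n)\<bar> \<le> 1 * \<bar>y n\<bar>"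
      unfolding y_Suc abs_mult by (intro mult_right_mono) auto
    with Suc show ?case
      by simp
  qed simp
  have "filterlim (\<lambda>n. real (?\<tau> n)) at_top sequentially"
    by (rule filterlim_at_top_mono[OF filterlim_real_sequentially])
      (use \<tau> in \<open>auto intro!: always_eventually less_imp_le\<close>)
  then have "(\<lambda>n. \<bar>y 0\<bar> / real (?\<tau> n)) \<longlonglongrightarrow> 0"
    by (intro tendsto_divide_0[OF tendsto_const] filterlim_at_top_imp_at_infinity)
  then have "(\<lambda>n. y n / real (?\<tau> n)) \<longlonglongrightarrow> 0"
    by (rule Lim_null_comparison[rotated])
      (auto intro!: always_eventually divide_right_mono y_bound)
  then have "(\<lambda>n. gain / real ?\<tau>\<^sub>0 + y n / real (?\<tau> n)) \<longlonglongrightarrow> gain / real ?\<tau>\<^sub>0 + 0"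
    by (intro tendsto_intros)
  moreover have "gain / real ?\<tau>\<^sub>0 + y n / real (?\<tau> n) = mean_X n / real (?\<tau> n)" for n
    using \<tau>[of n] by (simp add: y_def field_simps)
  ultimately show ?thesis
    by simp
qed

theorem theorem4p3:
  fixes G\<^sub>0 :: "'v mgraph" and h :: 'v and k :: "nat \<Rightarrow> nat" and a b :: real
    and \<tau>\<^sub>0 d X\<^sub>0 :: nat and \<tau> :: "nat \<Rightarrow> nat"
  assumes "is_seed G\<^sub>0 h"
    and "\<tau>\<^sub>0 = card (verts G\<^sub>0)"
    and "building_sequence \<tau>\<^sub>0 k a b"
    and "\<tau> = tau \<tau>\<^sub>0 k"
    and "d = min_degree G\<^sub>0"
    and "X\<^sub>0 = num_degree G\<^sub>0 d"
  shows "(\<forall>n\<ge>1. measure_pmf.expectation (network G\<^sub>0 h k n) (\<lambda>G. real (num_degree G d)) =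
           (real X\<^sub>0 - of_bool (vdegree G\<^sub>0 h = d)) *
             (\<Sum>i=1..n. real (k (i - 1)) *
                (\<Prod>j=i+1..n. 1 - real (k (j - 1)) / real (\<tau> (j - 1)))) +
           real X\<^sub>0 * (\<Prod>j=1..n. 1 - real (k (j - 1)) / real (\<tau> (j - 1)))) \<and>
         (\<lambda>n. measure_pmf.expectation (network G\<^sub>0 h k n)
            (\<lambda>G. real (num_degree G d) / real (\<tau> n)))
           \<longlonglongrightarrow> (real X\<^sub>0 - of_bool (vdegree G\<^sub>0 h = d)) / real \<tau>\<^sub>0"
proof -
  interpret hooking G\<^sub>0 h k a b
    using assms by unfold_locales auto
  have X: "measure_pmf.expectation (network G\<^sub>0 h k n) (\<lambda>G. real (num_degree G d)) = mean_X n" for n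
    by (simp add: mean_X_def assms)
  have "mean_X n =
      gain * (\<Sum>i=1..n. real (k (i - 1)) *
        (\<Prod>j=i+1..n. 1 - real (k (j - 1)) / real (\<tau> (j - 1)))) +
      mean_X 0 * (\<Prod>j=1..n. 1 - real (k (j - 1)) / real (\<tau> (j - 1)))" for n
    by (rule affine_recurrence_closed_form) (simp add: mean_X_Suc assms)
  moreover have "gain = real X\<^sub>0 - of_bool (vdegree G\<^sub>0 h = d)" "mean_X 0 = real X\<^sub>0"
    by (simp_all add: gain_def mean_X_0 assms)
  moreover note mean_X_proportion_tendsto
  ultimately show ?thesis
    \<comment> \<open>The order is a constant for each \<open>n\<close> and leaves the
      expectation.\<close>
    by (simp add: X assms(2,4))
qed

end
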